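(* Suppose that $X\subseteq\mathbb{R}^{mn}$ is convex and closed, that the solution set $D^*$ of the problem $\min\{f(x) : x\in X,\ Ax=b\}$ is nonempty, and that $f:\mathbb{R}^{mn}\to\mathbb{R}$ is convex. Suppose that $F^*\cap F_L\neq\varnothing$. Let $\{w^k\}$, $w^k=(x^k,y^k)$, be generated by Method (PDM) with index sets $I_k\subseteq L$ and stepsizes $\lambda_k$ such that, for some $\tau\in(0,1)$, $$\lambda_k\in\left[\tau,\ \frac{\sqrt{1-\tau}}{\sqrt{2}\,\|A_{(k)}\|}\right]\quad\text{for all } k\ge 1.$$ Then: (i) the sequence $\{w^k\}$ has limit points; (ii) if each $I_k$ is a basic index set, all the limit points of $\{w^k\}$ belong to $W^*$; (iii) if there exists a nonempty basic index set $I\subseteq L$ such that $I\subseteq I_k$ for all $k\ge1$ and $I=I_{k_s}$ for some infinite subsequence $\{w^{k_s}\}$, then the sequence $\{w^k\}$ converges to a point of $W^*$.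
   Context: Let $m,n,l$ be positive integers and $L=\{1,\dots,l\}$. Let $X\subseteq\mathbb{R}^{mn}$, $f:\mathbb{R}^{mn}\to\mathbb{R}$, let $A$ be a real matrix with $ln$ rows and $mn$ columns consisting of stacked $n\times mn$ blocks $A_1,\dots,A_l$, and let $b=(b_i)_{i\in L}\in\mathbb{R}^{ln}$ with $b_i\in\mathbb{R}^n$. For $I\subseteq L$, $A_I$ is the matrix of stacked blocks $A_i$, $i\in I$, $b_I=(b_i)_{i\in I}$ (so $A_L=A$, $b_L=b$), and $F_I=\{x\in\mathbb{R}^{mn}: A_Ix=b_I\}$ ($F_\varnothing=\mathbb{R}^{mn}$). $F^*$ is the solution set of $\min\{f(x): x\in X\}$. For $I\subset J\subseteq L$ (equality allowed), $I$ is a basic index set with respect to $J$ if, for every $x\in\mathbb{R}^{mn}$, $A_Ix=b_I$ implies $A_Jx=b_J$. A basic index set is a basic index set with respect to $L$. Lagrange function: $\mathcal{L}(x,y)=f(x)+\langle y,Ax-b\rangle$. For $I\subseteq L$ let $Y_I=\{y=(y_i)_{i\in L}\in\mathbb{R}^{ln} : y_i=\mathbf{0}\in\mathbb{R}^n \text{ for } i\notin I\}$. A pair $(x^*,y^* )\in X\times Y_I$ is a saddle point for index set $I$ if $\mathcal{L}(x^*,y)\le\mathcal{L}(x^*,y^* )\le\mathcal{L}(x,y^* )$ for all $y\in Y_I$ and all $x\in X$. $W^*_I$ denotes the set of saddle points for index set $I$, and $W^*=W^*_L$. Method (PDM): choose $I_0\subseteq L$ and $w^0=(x^0,y^0)\in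 X\times Y_{I_0}$. For $k=1,2,\dots$ choose $I_k\subseteq L$ and $\lambda_k>0$, and set $p^k=\pi_{Y_{(k)}}[y^{k-1}+\lambda_k(Ax^{k-1}-b)]$, $x^k=\operatorname{argmin}\{f(x)+\langle p^k,Ax-b\rangle+0.5\lambda_k^{-1}\|x-x^{k-1}\|^2 : x\in X\}$, $y^k=\pi_{Y_{(k)}}[y^{k-1}+\lambda_k(Ax^k-b)]$, where $\pi_U$ is Euclidean projection onto $U$. The subscript $(k)$ abbreviates $I_k$: $Y_{(k)}=Y_{I_k}$, $A_{(k)}=A_{I_k}$. $\|\cdot\|$ is the Euclidean norm for vectors and the induced operator norm for matrices; if $\|A_{(k)}\|=0$ the upper bound on $\lambda_k$ is read as $+\infty$ (with $\lambda_k$ finite). A limit point of a sequence is the limit of some convergent subsequence. *)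

theory Defs
  imports "HOL-Analysis.Analysis"
begin

text \<open>
  \<open>CARD('m) = m\<close>, \<open>CARD('n) = n\<close>, \<open>L = (UNIV :: 'l set)\<close>. A coordinate \<open>(i, j) :: 'l \<times> 'n\<close> of
  a vector in \<open>\<real>\<^sup>l\<^sup>n\<close>, or such a row of \<open>A\<close>, is entry \<open>j\<close> of the \<open>i\<close>-th block.
\<close>

definition block :: "real ^ ('l::finite \<times> 'n::finite) \<Rightarrow> 'l \<Rightarrow> real ^ 'n" where
  "block y i = (\<chi> j. y $ (i, j))"

definition block_mat ::
    "real ^ 'c::finite ^ ('l::finite \<times> 'n::finite) \<Rightarrow> 'l \<Rightarrow> real ^ 'c ^ 'n" where
  "block_mat A i = (\<chi> j. A $ (i, j))"

text \<open>
  The stacked matrix \<open>A\<^sub>I\<close> and vector \<open>b\<^sub>I\<close> have a number of rows that depends on \<open>I\<close>. They are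
  padded here with zero rows for the blocks outside \<open>I\<close>; this affects neither the solution set of
  \<open>A\<^sub>I x = b\<^sub>I\<close> nor \<open>\<parallel>A\<^sub>I x\<parallel>\<close>, hence not the operator norm (lemmas
  \<open>sub_mat_eq_sub_vec_iff\<close> and \<open>norm_sub_mat_mult\<close>).
\<close>

definition sub_mat ::
    "real ^ 'c::finite ^ ('l::finite \<times> 'n::finite) \<Rightarrow> 'l set \<Rightarrow> real ^ 'c ^ ('l \<times> 'n)" where
  "sub_mat A I = (\<chi> r. if fst r \<in> I then A $ r else 0)"

definition sub_vec ::
    "real ^ ('l::finite \<times> 'n::finite) \<Rightarrow> 'l set \<Rightarrow> real ^ ('l \<times> 'n)" where
  "sub_vec b I = (\<chi> r. if fst r \<in> I then b $ r else 0)"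

definition mat_norm :: "real ^ 'c::finite ^ 'r::finite \<Rightarrow> real" where
  "mat_norm M = onorm ((*v) M)"

definition feasible ::
    "real ^ 'c::finite ^ ('l::finite \<times> 'n::finite) \<Rightarrow> real ^ ('l \<times> 'n) \<Rightarrow> 'l set \<Rightarrow> (real ^ 'c) set"
  where "feasible A b I = {x. sub_mat A I *v x = sub_vec b I}"

definition solution_set :: "('a \<Rightarrow> real) \<Rightarrow> 'a set \<Rightarrow> 'a set" where
  "solution_set f S = {x. is_arg_min f (\<lambda>z. z \<in> S) x}"

definition basic_index_set_wrt ::
    "real ^ 'c::finite ^ ('l::finite \<times> 'n::finite) \<Rightarrow> real ^ ('l \<times> 'n) \<Rightarrow> 'l set \<Rightarrow> 'l set \<Rightarrow> bool"
  where
  "basic_index_set_wrt A b I J \<longleftrightarrow>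
     I \<subseteq> J \<and> (\<forall>x. sub_mat A I *v x = sub_vec b I \<longrightarrow> sub_mat A J *v x = sub_vec b J)"

definition basic_index_set ::
    "real ^ 'c::finite ^ ('l::finite \<times> 'n::finite) \<Rightarrow> real ^ ('l \<times> 'n) \<Rightarrow> 'l set \<Rightarrow> bool" where
  "basic_index_set A b I \<longleftrightarrow> basic_index_set_wrt A b I UNIV"

definition lagrange ::
    "(real ^ 'c::finite \<Rightarrow> real) \<Rightarrow> real ^ 'c ^ 'r::finite \<Rightarrow> real ^ 'r \<Rightarrow>
     real ^ 'c \<Rightarrow> real ^ 'r \<Rightarrow> real" where
  "lagrange f A b x y = f x + y \<bullet> (A *v x - b)"

definition dual_space :: "'l set \<Rightarrow> (real ^ ('l::finite \<times> 'n::finite)) set" where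
  "dual_space I = {y. \<forall>i. i \<notin> I \<longrightarrow> block y i = 0}"

definition saddle_points ::
    "(real ^ 'c::finite \<Rightarrow> real) \<Rightarrow> (real ^ 'c) set \<Rightarrow> real ^ 'c ^ ('l::finite \<times> 'n::finite) \<Rightarrow>
     real ^ ('l \<times> 'n) \<Rightarrow> 'l set \<Rightarrow> ((real ^ 'c) \<times> (real ^ ('l \<times> 'n))) set" where
  "saddle_points f X A b I =
     {(xs, ys). xs \<in> X \<and> ys \<in> dual_space I \<and>
        (\<forall>y\<in>dual_space I. lagrange f A b xs y \<le> lagrange f A b xs ys) \<and>
        (\<forall>x\<in>X. lagrange f A b xs ys \<le> lagrange f A b x ys)}"

text \<open>
  \<open>is_arg_min\<close> stands for equality with the argmin: for convex \<open>f\<close> and \<open>X\<close> the objective of the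
  \<open>x\<close>-step is strictly convex, so a minimiser over \<open>X\<close> is unique.
\<close>

definition PDM ::
    "(real ^ 'c::finite \<Rightarrow> real) \<Rightarrow> (real ^ 'c) set \<Rightarrow> real ^ 'c ^ ('l::finite \<times> 'n::finite) \<Rightarrow>
     real ^ ('l \<times> 'n) \<Rightarrow> (nat \<Rightarrow> 'l set) \<Rightarrow> (nat \<Rightarrow> real) \<Rightarrow>
     (nat \<Rightarrow> real ^ ('l \<times> 'n)) \<Rightarrow> (nat \<Rightarrow> (real ^ 'c) \<times> (real ^ ('l \<times> 'n))) \<Rightarrow> bool" where
  "PDM f X A b Is lam p w \<longleftrightarrow>
     (let x = (\<lambda>k. fst (w k)); y = (\<lambda>k. snd (w k)) in
      x 0 \<in> X \<and> y 0 \<in> dual_space (Is 0) \<and>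
      (\<forall>k\<ge>1.
         lam k > 0 \<and>
         p k = closest_point (dual_space (Is k)) (y (k - 1) + lam k *\<^sub>R (A *v x (k - 1) - b)) \<and>
         is_arg_min
           (\<lambda>z. f z + p k \<bullet> (A *v z - b) + 1 / 2 * inverse (lam k) * (norm (z - x (k - 1)))\<^sup>2)
           (\<lambda>z. z \<in> X) (x k) \<and>
         y k = closest_point (dual_space (Is k)) (y (k - 1) + lam k *\<^sub>R (A *v x k - b))))"

definition limit_points :: "(nat \<Rightarrow> 'a::topological_space) \<Rightarrow> 'a set" where
  "limit_points w = {u. \<exists>r. strict_mono r \<and> (w \<circ> r) \<longlonglongrightarrow> u}"

lemma sub_mat_mult_nth:
  "(sub_mat A I *v x) $ (i, j) = (if i \<in> I then (block_mat A i *v x) $ j else 0)"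
  by (simp add: sub_mat_def block_mat_def matrix_vector_mult_def)

lemma sub_mat_eq_sub_vec_iff:
  "sub_mat A I *v x = sub_vec b I \<longleftrightarrow> (\<forall>i\<in>I. block_mat A i *v x = block b i)"
  by (auto simp: vec_eq_iff sub_mat_mult_nth sub_vec_def block_def)

lemma sub_mat_UNIV [simp]: "sub_mat A UNIV = A" "sub_vec b UNIV = b"
  by (simp_all add: sub_mat_def sub_vec_def)

lemma norm_sub_mat_mult:
  "(norm (sub_mat A I *v x))\<^sup>2 = (\<Sum>i\<in>I. (norm (block_mat A i *v x))\<^sup>2)"
proof -
  have "(norm (sub_mat A I *v x))\<^sup>2 = (\<Sum>r\<in>UNIV. ((sub_mat A I *v x) $ r)\<^sup>2)"
    unfolding power2_norm_eq_inner inner_vec_def by (simp add: power2_eq_square)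
  also have "\<dots> = (\<Sum>i\<in>UNIV. \<Sum>j\<in>UNIV. ((sub_mat A I *v x) $ (i, j))\<^sup>2)"
    by (simp add: UNIV_Times_UNIV[symmetric] sum.cartesian_product del: UNIV_Times_UNIV)
  also have "\<dots> = (\<Sum>i\<in>UNIV. if i \<in> I then (norm (block_mat A i *v x))\<^sup>2 else 0)"
    by (intro sum.cong refl)
      (simp add: sub_mat_mult_nth power2_norm_eq_inner inner_vec_def flip: power2_eq_square)
  also have "\<dots> = (\<Sum>i\<in>I. (norm (block_mat A i *v x))\<^sup>2)"
    by (simp add: sum.If_cases)
  finally show ?thesis .
qed

end

theory Submission
  imports Defs
begin

text \<open>
  The method is a proximal step in the primal variable, taken at a predicted multiplier, followed
  by a dual ascent step confined to the blocks in \<open>I\<^sub>k\<close>. Convergence rests on Fejer monotonicity.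

  Adding the optimality inequality of the proximal step to the exact Pythagorean identity of the
  dual step, and using that \<open>w\<^sup>*\<close> is a saddle point for \<open>I\<^sub>k\<close>, bounds
  \<open>\<parallel>w\<^sup>k - w\<^sup>*\<parallel>\<^sup>2 + \<parallel>w\<^sup>k - w\<^sup>k\<^sup>-\<^sup>1\<parallel>\<^sup>2\<close> by \<open>\<parallel>w\<^sup>k\<^sup>-\<^sup>1 - w\<^sup>*\<parallel>\<^sup>2\<close> plus an error caused by predicting the
  multiplier at \<open>x\<^sup>k\<^sup>-\<^sup>1\<close> instead of \<open>x\<^sup>k\<close>. The error is at most
  \<open>2 \<lambda>\<^sub>k \<parallel>A\<^sub>(\<^sub>k\<^sub>)\<parallel> \<parallel>x\<^sup>k - x\<^sup>k\<^sup>-\<^sup>1\<parallel> \<parallel>y\<^sup>k - y\<^sup>k\<^sup>-\<^sup>1\<parallel>\<close>, and the stepsize rule bounds \<open>\<lambda>\<^sub>k \<parallel>A\<^sub>(\<^sub>k\<^sub>)\<parallel>\<close> by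
  a constant \<open>c < 1\<close>. Hence \<open>\<parallel>w\<^sup>k - w\<^sup>*\<parallel>\<close> never increases and the increments tend to zero
  (\<open>pdm_step_fejer\<close>, \<open>increments_tendsto_0\<close>).

  This needs one \<open>w\<^sup>*\<close> that is a saddle point for every \<open>I\<^sub>k\<close> at once. If \<open>x\<^sup>*\<close> minimises \<open>f\<close> over \<open>X\<close>
  and satisfies \<open>A x\<^sup>* = b\<close>, then \<open>(x\<^sup>*, 0)\<close> is one, since the zero multiplier lies in every
  \<open>Y\<^sub>I\<close>. So the iterates are bounded, which gives limit points.

  Along a subsequence on which \<open>I\<^sub>k\<close> is a constant \<open>I\<close> (one exists, as \<open>L\<close> has finitely many subsets),
  vanishing increments turn the step into the saddle point conditions for \<open>I\<close> in the limit
  (\<open>pdm_step_limit\<close>), and a saddle point for a basic index set is a saddle point for every larger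
  index set (\<open>saddle_points_basic_mono\<close>), in particular for \<open>L\<close>. If the \<open>I\<^sub>k\<close> all contain a basic \<open>I\<close> that recurs, a limit
  point along its recurrences is thus a saddle point for every \<open>I\<^sub>k\<close>. The distances to it never
  increase and tend to zero along a subsequence, so the whole sequence converges to it.
\<close>

section \<open>Block projections\<close>

lemma block_eq_0_iff: "block y i = 0 \<longleftrightarrow> (\<forall>j. y $ (i, j) = 0)"
  by (simp add: block_def vec_eq_iff)

lemma mem_dual_space_iff: "y \<in> dual_space I \<longleftrightarrow> sub_vec y I = y"
  unfolding dual_space_def block_eq_0_iff by (auto simp: sub_vec_def vec_eq_iff)

lemma linear_sub_vec: "linear (\<lambda>v. sub_vec v I)"
  by (rule linearI) (auto simp: sub_vec_def vec_eq_iff)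

lemmas sub_vec_add = linear_add[OF linear_sub_vec]
  and sub_vec_diff = linear_diff[OF linear_sub_vec]
  and sub_vec_scaleR = linear_scale[OF linear_sub_vec]

lemma sub_vec_idem [simp]: "sub_vec (sub_vec v I) I = sub_vec v I"
  by (simp add: sub_vec_def vec_eq_iff)

lemma sub_vec_in_dual_space: "sub_vec v I \<in> dual_space I"
  by (simp add: mem_dual_space_iff)

lemma inner_sub_vec: "sub_vec u I \<bullet> v = u \<bullet> sub_vec v I"
  by (auto simp: inner_vec_def sub_vec_def intro!: sum.cong)

lemma inner_dual_space: "y \<in> dual_space I \<Longrightarrow> y \<bullet> v = y \<bullet> sub_vec v I"
  by (metis inner_sub_vec mem_dual_space_iff)

lemma norm_sub_vec_le: "norm (sub_vec v I) \<le> norm v"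
  by (rule norm_le_componentwise_cart) (simp add: sub_vec_def)

lemma sub_vec_mult: "sub_vec (A *v x) I = sub_mat A I *v x"
  by (simp add: sub_vec_def sub_mat_def vec_eq_iff matrix_vector_mult_def)

lemma sub_vec_residual: "sub_vec (A *v x - b) I = sub_mat A I *v x - sub_vec b I"
  by (simp add: sub_vec_diff sub_vec_mult)

lemma dual_space_mono: "I \<subseteq> J \<Longrightarrow> dual_space I \<subseteq> dual_space J"
  by (auto simp: dual_space_def)

lemma subspace_dual_space: "subspace (dual_space I)"
  by (auto simp: subspace_def mem_dual_space_iff sub_vec_add sub_vec_scaleR
      linear_0[OF linear_sub_vec])

lemma closest_point_dual_space:
  fixes v :: "real ^ ('l::finite \<times> 'n::finite)"
  shows "closest_point (dual_space I) v = sub_vec v I"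
proof (rule closest_point_unique[symmetric])
  show "convex (dual_space I)" "closed (dual_space I)"
    by (simp_all add: subspace_dual_space subspace_imp_convex closed_subspace)
  show "\<forall>z\<in>dual_space I. dist v (sub_vec v I) \<le> dist v z"
  proof
    fix z :: "real ^ ('l \<times> 'n)"
    assume "z \<in> dual_space I"
    then have z: "sub_vec z I = z" by (simp add: mem_dual_space_iff)
    show "dist v (sub_vec v I) \<le> dist v z"
      unfolding dist_norm
    proof (rule norm_le_componentwise_cart)
      fix r
      have "fst r \<notin> I \<Longrightarrow> z $ r = 0"
        using arg_cong[OF z, of "\<lambda>u. u $ r"] by (simp add: sub_vec_def)
      then show "norm ((v - sub_vec v I) $ r) \<le> norm ((v - z) $ r)"
        by (simp add: sub_vec_def)
    qed
  qed
qed (rule sub_vec_in_dual_space)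

lemma mat_norm_nonneg: "0 \<le> mat_norm M"
  unfolding mat_norm_def by (rule onorm_pos_le) (rule matrix_vector_mul_bounded_linear)

lemma norm_mult_le_mat_norm: "norm (M *v x) \<le> mat_norm M * norm x"
  unfolding mat_norm_def by (rule onorm) (rule matrix_vector_mul_bounded_linear)

section \<open>Saddle points for an index set\<close>

text \<open>
  The Lagrange function is affine in \<open>y\<close>, so it is bounded above on the subspace \<open>Y\<^sub>I\<close> only if the
  residual has no component in \<open>Y\<^sub>I\<close>: maximality in \<open>y\<close> is feasibility for \<open>I\<close>. The pairing
  \<open>\<langle>y\<^sup>*, A x\<^sup>* - b\<rangle>\<close> then vanishes and only the minimality of \<open>x\<^sup>*\<close> remains.
\<close>

lemma saddle_points_iff:
  "(xs, ys) \<in> saddle_points f X A b I \<longleftrightarrow>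
     xs \<in> X \<and> ys \<in> dual_space I \<and> sub_mat A I *v xs = sub_vec b I \<and>
     (\<forall>x\<in>X. f xs \<le> f x + ys \<bullet> (A *v x - b))"
  (is "?L \<longleftrightarrow> ?R")
proof
  assume L: ?L
  then have ys: "ys \<in> dual_space I" by (simp add: saddle_points_def)
  let ?g = "sub_vec (A *v xs - b) I"
  \<comment> \<open>Moving \<open>ys\<close> along the projected residual gains its squared norm, which must then vanish.\<close>
  have "ys + ?g \<in> dual_space I"
    by (intro subspace_add[OF subspace_dual_space] ys sub_vec_in_dual_space)
  then have "lagrange f A b xs (ys + ?g) \<le> lagrange f A b xs ys"
    using L by (simp add: saddle_points_def)
  then have "?g \<bullet> (A *v xs - b) \<le> 0"
    by (simp add: lagrange_def inner_add_left)
  then have "?g \<bullet> ?g \<le> 0"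
    by (metis inner_dual_space sub_vec_in_dual_space)
  then have g: "?g = 0" by (metis inner_eq_zero_iff inner_ge_zero order_antisym)
  have "ys \<bullet> (A *v xs - b) = 0"
    using inner_dual_space[OF ys, of "A *v xs - b"] g by simp
  then show ?R
    using L g by (auto simp: saddle_points_def lagrange_def sub_vec_residual)
next
  assume R: ?R
  then have "sub_vec (A *v xs - b) I = 0" by (simp add: sub_vec_residual)
  then have "\<forall>y\<in>dual_space I. y \<bullet> (A *v xs - b) = 0"
    using inner_dual_space by (metis inner_zero_right)
  then show ?L using R by (auto simp: saddle_points_def lagrange_def)
qed

lemma minimiser_saddle_point:
  assumes "xs \<in> solution_set f X" and "xs \<in> feasible A b UNIV"
  shows "(xs, 0) \<in> saddle_points f X A b I"
  unfolding saddle_points_iff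
  using assms
  by (auto simp: solution_set_def is_arg_min_linorder feasible_def subspace_0[OF subspace_dual_space]
      sub_vec_mult[symmetric])

lemma saddle_points_basic_mono:
  assumes "basic_index_set A b I" and "I \<subseteq> J"
  shows "saddle_points f X A b I \<subseteq> saddle_points f X A b J"
proof clarify
  fix xs ys assume S: "(xs, ys) \<in> saddle_points f X A b I"
  then have "A *v xs = b"
    using assms(1) by (simp add: saddle_points_iff basic_index_set_def basic_index_set_wrt_def)
  then have "sub_mat A J *v xs = sub_vec b J" by (simp flip: sub_vec_mult)
  then show "(xs, ys) \<in> saddle_points f X A b J"
    using S dual_space_mono[OF assms(2)] by (auto simp: saddle_points_iff)
qed

section \<open>One step of the method\<close>

text \<open>
  A proximal minimiser beats every competitor by the squared distance to it, because the quadratic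
  term makes the objective strongly convex. Minimality is compared only along the segment from \<open>z\<close>
  towards the competitor, and the segment is then shrunk to \<open>z\<close>.
\<close>

lemma prox_three_point:
  fixes h :: "'a::real_inner \<Rightarrow> real"
  assumes h: "convex_on X h" and z: "z \<in> X" and x: "x \<in> X" and "0 \<le> q"
    and min: "\<And>u. u \<in> X \<Longrightarrow> h z + q * (norm (z - a))\<^sup>2 \<le> h u + q * (norm (u - a))\<^sup>2"
  shows "h z + q * (norm (z - a))\<^sup>2 + q * (norm (x - z))\<^sup>2 \<le> h x + q * (norm (x - a))\<^sup>2"
proof -
  define S where "S = q * (norm (x - z))\<^sup>2"
  define B where "B = 2 * q * ((z - a) \<bullet> (x - z))"
  have step: "h z \<le> h x + B + t * S" if t: "0 < t" "t < 1" for t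
  proof -
    define u where "u = (1 - t) *\<^sub>R z + t *\<^sub>R x"
    have "u \<in> X"
      unfolding u_def using convexD[OF convex_on_imp_convex[OF h] z x, of "1 - t" t] t by simp
    have "h u \<le> (1 - t) * h z + t * h x"
      unfolding u_def using convex_onD[OF h, of t z x] z x t by simp
    moreover have "q * (norm (u - a))\<^sup>2 = q * (norm (z - a))\<^sup>2 + t * B + t * (t * S)"
    proof -
      have expand: "(norm (d + t *\<^sub>R e))\<^sup>2 = (norm d)\<^sup>2 + 2 * t * (d \<bullet> e) + t * (t * (norm e)\<^sup>2)"
        for d e :: 'a
        by (simp add: power2_norm_eq_inner inner_add_left inner_add_right inner_commute)
      have u: "u - a = (z - a) + t *\<^sub>R (x - z)" by (simp add: u_def algebra_simps)
      show ?thesis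
        unfolding u expand by (simp add: B_def S_def distrib_left)
    qed
    ultimately have "t * h z \<le> t * (h x + B + t * S)"
      using min[OF \<open>u \<in> X\<close>] by (simp add: algebra_simps)
    then show ?thesis using t by simp
  qed
  have "h z \<le> h x + B + 0 * S"
  proof (rule tendsto_lowerbound)
    show "((\<lambda>t. h x + B + t * S) \<longlongrightarrow> h x + B + 0 * S) (at_right (0::real))"
      by (intro tendsto_intros)
    show "\<forall>\<^sub>F t in at_right (0::real). h z \<le> h x + B + t * S"
      using step by (auto simp: eventually_at_right[of 0 1] intro!: exI[of _ 1])
  qed simp
  moreover have "B = q * (norm (x - a))\<^sup>2 - q * (norm (z - a))\<^sup>2 - q * (norm (x - z))\<^sup>2"
    by (simp add: B_def power2_norm_eq_inner inner_diff_left inner_diff_right inner_commute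
        algebra_simps)
  ultimately show ?thesis by simp
qed

text \<open>
  What the analysis uses of one iteration: the dual update as a block projection, and the argmin
  replaced by its three-point inequality. The vector \<open>q\<close> is the predicted multiplier \<open>p\<^sup>k\<close>.
\<close>

definition pdm_step ::
    "(real ^ 'c::finite \<Rightarrow> real) \<Rightarrow> (real ^ 'c) set \<Rightarrow> real ^ 'c ^ ('l::finite \<times> 'n::finite) \<Rightarrow>
     real ^ ('l \<times> 'n) \<Rightarrow> 'l set \<Rightarrow> real \<Rightarrow> (real ^ 'c) \<times> (real ^ ('l \<times> 'n)) \<Rightarrow>
     (real ^ 'c) \<times> (real ^ ('l \<times> 'n)) \<Rightarrow> bool" where
  "pdm_step f X A b I t = (\<lambda>(x, y) (x', y'). 0 < t \<and> x' \<in> X \<and>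
     y' = sub_vec (y + t *\<^sub>R (A *v x' - b)) I \<and>
     (let q = sub_vec (y + t *\<^sub>R (A *v x - b)) I in
       \<forall>z\<in>X. 2 * t * (f x' + q \<bullet> (A *v x' - b)) + (norm (x' - x))\<^sup>2 + (norm (z - x'))\<^sup>2
         \<le> 2 * t * (f z + q \<bullet> (A *v z - b)) + (norm (z - x))\<^sup>2))"

lemma PDM_step:
  assumes PDM: "PDM f X A b Is lam p w" and f: "convex_on UNIV f" and X: "convex X" and "k \<ge> 1"
  shows "pdm_step f X A b (Is k) (lam k) (w (k - 1)) (w k)"
proof -
  obtain x y where prev: "w (k - 1) = (x, y)" by fastforce
  obtain x' y' where cur: "w k = (x', y')" by fastforce
  define t where "t = lam k"
  define q where "q = sub_vec (y + t *\<^sub>R (A *v x - b)) (Is k)"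
  have t: "0 < t" and y': "y' = sub_vec (y + t *\<^sub>R (A *v x' - b)) (Is k)"
    and am: "is_arg_min
      (\<lambda>z. f z + q \<bullet> (A *v z - b) + 1 / 2 * inverse t * (norm (z - x))\<^sup>2) (\<lambda>z. z \<in> X) x'"
    using PDM \<open>k \<ge> 1\<close>
    by (auto simp: PDM_def Let_def prev cur closest_point_dual_space q_def t_def
        simp del: One_nat_def)
  have x': "x' \<in> X" using am by (simp add: is_arg_min_linorder)
  have "convex_on X (\<lambda>z. q \<bullet> (A *v z - b))"
    using X
    by (auto simp: convex_on_def matrix_vector_right_distrib inner_diff_right inner_add_right
        matrix_vector_mult_scaleR algebra_simps simp flip: distrib_right)
  then have h: "convex_on X (\<lambda>z. f z + q \<bullet> (A *v z - b))"
    using f X by (intro convex_on_add) (auto intro: convex_on_subset)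
  have "2 * t * (f x' + q \<bullet> (A *v x' - b)) + (norm (x' - x))\<^sup>2 + (norm (z - x'))\<^sup>2
      \<le> 2 * t * (f z + q \<bullet> (A *v z - b)) + (norm (z - x))\<^sup>2" if "z \<in> X" for z
  proof -
    have "f x' + q \<bullet> (A *v x' - b) + 1 / 2 * inverse t * (norm (x' - x))\<^sup>2
          + 1 / 2 * inverse t * (norm (z - x'))\<^sup>2
        \<le> f z + q \<bullet> (A *v z - b) + 1 / 2 * inverse t * (norm (z - x))\<^sup>2"
      using am t by (intro prox_three_point[OF h x' that]) (auto simp: is_arg_min_linorder)
    from mult_left_mono[OF this, of "2 * t"] t show ?thesis
      by (simp add: distrib_left mult.assoc[symmetric])
  qed
  then have "pdm_step f X A b (Is k) t (x, y) (x', y')"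
    using t x' y' by (simp add: pdm_step_def Let_def q_def)
  then show ?thesis by (simp only: prev cur t_def)
qed

lemma pdm_step_dual:
  assumes "pdm_step f X A b I t (x, y) (x', y')"
  shows "t *\<^sub>R sub_vec (A *v x' - b) I = sub_vec (y' - y) I"
    and "y' \<in> dual_space I"
    and "sub_vec (y + t *\<^sub>R (A *v x - b)) I - y' = t *\<^sub>R (sub_mat A I *v (x - x'))"
proof -
  have y': "y' = sub_vec (y + t *\<^sub>R (A *v x' - b)) I" using assms by (simp add: pdm_step_def)
  show "t *\<^sub>R sub_vec (A *v x' - b) I = sub_vec (y' - y) I"
    by (simp add: y' sub_vec_diff) (simp add: sub_vec_add sub_vec_scaleR sub_vec_diff)
  show "y' \<in> dual_space I"
    by (simp add: y' sub_vec_in_dual_space)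
  show "sub_vec (y + t *\<^sub>R (A *v x - b)) I - y' = t *\<^sub>R (sub_mat A I *v (x - x'))"
    by (simp add: y' sub_vec_add sub_vec_diff sub_vec_scaleR matrix_vector_mult_diff_distrib
        sub_vec_mult algebra_simps)
qed

lemma pdm_step_prediction_error:
  assumes step: "pdm_step f X A b I t (x, y) (x', y')" and c: "t * mat_norm (sub_mat A I) \<le> c"
  shows "norm (sub_vec (y + t *\<^sub>R (A *v x - b)) I - y') \<le> c * norm (x' - x)"
proof -
  have t: "0 < t" using step by (simp add: pdm_step_def)
  have "norm (sub_vec (y + t *\<^sub>R (A *v x - b)) I - y') = t * norm (sub_mat A I *v (x - x'))"
    using t by (simp add: pdm_step_dual(3)[OF step])
  also have "\<dots> \<le> t * (mat_norm (sub_mat A I) * norm (x - x'))"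
    using t by (intro mult_left_mono norm_mult_le_mat_norm) auto
  also have "\<dots> \<le> c * norm (x - x')"
    using mult_right_mono[OF c, of "norm (x - x')"] by (simp add: mult.assoc)
  finally show ?thesis by (simp add: norm_minus_commute)
qed

text \<open>
  In the sum of the primal and the dual inequality everything cancels against the saddle point
  inequality except \<open>\<langle>q - y', A x' - b\<rangle>\<close>. This pairing sees only the blocks in \<open>I\<close>, where the
  residual is, up to the stepsize, the dual increment itself. That makes the error quadratic
  in the increments, so it lowers the coefficient of the squared increment from \<open>1\<close> to \<open>1 - c\<close>.
\<close>

lemma pdm_step_fejer:
  assumes step: "pdm_step f X A b I t w w'" and c: "t * mat_norm (sub_mat A I) \<le> c"
    and ws: "ws \<in> saddle_points f X A b I"
  shows "(dist w' ws)\<^sup>2 + (1 - c) * (dist w' w)\<^sup>2 \<le> (dist w ws)\<^sup>2"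
proof -
  obtain x y where w: "w = (x, y)" by fastforce
  obtain x' y' where w': "w' = (x', y')" by fastforce
  obtain xs ys where wseq: "ws = (xs, ys)" by fastforce
  note step = step[unfolded w w'] and ws = ws[unfolded wseq saddle_points_iff]
  define q where "q = sub_vec (y + t *\<^sub>R (A *v x - b)) I"
  define g where "g = A *v x' - b"
  have t: "0 < t" and x': "x' \<in> X" using step by (auto simp: pdm_step_def)
  have qI: "q \<in> dual_space I" by (simp add: q_def sub_vec_in_dual_space)
  note y'I = pdm_step_dual(2)[OF step]

  have "q \<bullet> (A *v xs - b) = 0"
    using inner_dual_space[OF qI, of "A *v xs - b"] ws by (simp add: sub_vec_residual)
  moreover have "2 * t * (f x' + q \<bullet> (A *v x' - b)) + (norm (x' - x))\<^sup>2 + (norm (xs - x'))\<^sup>2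
      \<le> 2 * t * (f xs + q \<bullet> (A *v xs - b)) + (norm (xs - x))\<^sup>2"
    using step ws by (simp add: pdm_step_def q_def Let_def)
  ultimately have primal:
    "2 * t * f x' + 2 * (t * (q \<bullet> g)) + (norm (x' - x))\<^sup>2 + (norm (xs - x'))\<^sup>2
      \<le> 2 * t * f xs + (norm (xs - x))\<^sup>2"
    by (simp add: g_def algebra_simps)

  have tg: "t * (v \<bullet> g) = v \<bullet> (y' - y)" if v: "v \<in> dual_space I" for v
  proof -
    have "t * (v \<bullet> g) = v \<bullet> (t *\<^sub>R sub_vec g I)" using inner_dual_space[OF v, of g] by simp
    also have "\<dots> = v \<bullet> sub_vec (y' - y) I" using pdm_step_dual(1)[OF step] by (simp add: g_def)
    also have "\<dots> = v \<bullet> (y' - y)" using inner_dual_space[OF v] by simp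
    finally show ?thesis .
  qed
  have dual: "(norm (ys - y'))\<^sup>2 + (norm (y' - y))\<^sup>2 + 2 * (t * ((ys - y') \<bullet> g)) = (norm (ys - y))\<^sup>2"
    using tg[OF subspace_diff[OF subspace_dual_space], of ys y'] ws y'I
    by (simp add: power2_norm_eq_inner inner_diff_left inner_diff_right inner_commute)

  have "f xs \<le> f x' + ys \<bullet> g" using ws x' by (simp add: g_def)
  from mult_left_mono[OF this, of "2 * t"] t
  have saddle: "2 * t * f xs \<le> 2 * t * f x' + 2 * (t * (ys \<bullet> g))"
    by (simp add: algebra_simps)

  have c0: "0 \<le> c"
    using c mult_nonneg_nonneg[OF less_imp_le[OF t] mat_norm_nonneg[of "sub_mat A I"]] by linarith
  have "\<bar>(q - y') \<bullet> (y' - y)\<bar> \<le> norm (q - y') * norm (y' - y)"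
    by (rule Cauchy_Schwarz_ineq2)
  also have "\<dots> \<le> c * norm (x' - x) * norm (y' - y)"
    using pdm_step_prediction_error[OF step c] by (intro mult_right_mono) (auto simp: q_def)
  finally have "- (c * (2 * norm (x' - x) * norm (y' - y))) \<le> 2 * (t * ((q - y') \<bullet> g))"
    using tg[OF subspace_diff[OF subspace_dual_space qI y'I]] by linarith
  moreover have "c * (2 * norm (x' - x) * norm (y' - y))
      \<le> c * ((norm (x' - x))\<^sup>2 + (norm (y' - y))\<^sup>2)"
    by (intro mult_left_mono c0 sum_squares_bound)
  ultimately have err: "- (c * ((norm (x' - x))\<^sup>2 + (norm (y' - y))\<^sup>2)) \<le> 2 * (t * ((q - y') \<bullet> g))"
    by linarith

  have "(norm (xs - x'))\<^sup>2 + (norm (ys - y'))\<^sup>2 + (1 - c) * ((norm (x' - x))\<^sup>2 + (norm (y' - y))\<^sup>2)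
      \<le> (norm (xs - x))\<^sup>2 + (norm (ys - y))\<^sup>2"
    using primal dual saddle err by (simp add: inner_diff_left algebra_simps)
  then show ?thesis
    by (simp add: w w' wseq dist_norm norm_Pair norm_minus_commute)
qed

text \<open>
  Stepsizes may be unbounded when \<open>A\<^sub>I = 0\<close>, so no limit of them is taken: only \<open>1 / \<lambda>\<close> and
  \<open>\<lambda> \<parallel>A\<^sub>I\<parallel>\<close>, which the stepsize rule bounds, enter the estimates.
\<close>

lemma pdm_step_limit:
  assumes step: "\<And>j. pdm_step f X A b I (t j) (u j) (v j)"
    and u: "u \<longlonglongrightarrow> ws" and v: "v \<longlonglongrightarrow> ws"
    and \<tau>: "0 < \<tau>" "\<And>j. \<tau> \<le> t j" and c: "\<And>j. t j * mat_norm (sub_mat A I) \<le> c"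
    and f: "continuous_on UNIV f" and X: "closed X"
  shows "ws \<in> saddle_points f X A b I"
proof -
  obtain xs ys where wseq: "ws = (xs, ys)" by fastforce
  define x y x' y' where "x j = fst (u j)" and "y j = snd (u j)"
    and "x' j = fst (v j)" and "y' j = snd (v j)" for j
  have step: "pdm_step f X A b I (t j) (x j, y j) (x' j, y' j)" for j
    using step[of j] by (simp add: x_def y_def x'_def y'_def)
  have x: "x \<longlonglongrightarrow> xs" and y: "y \<longlonglongrightarrow> ys" and x': "x' \<longlonglongrightarrow> xs" and y': "y' \<longlonglongrightarrow> ys"
    unfolding x_def y_def x'_def y'_def
    using tendsto_fst[OF u] tendsto_snd[OF u] tendsto_fst[OF v] tendsto_snd[OF v]
    by (simp_all add: wseq)
  have t: "0 < t j" for j using step[of j] by (simp add: pdm_step_def)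
  have dx: "(\<lambda>j. norm (x' j - x j)) \<longlonglongrightarrow> 0" and dy: "(\<lambda>j. norm (y' j - y j)) \<longlonglongrightarrow> 0"
    using tendsto_diff[OF x' x] tendsto_diff[OF y' y] by (simp_all add: tendsto_norm_zero)
  have A_lim: "(\<lambda>j. M *v x' j) \<longlonglongrightarrow> M *v xs" for M :: "real ^ 'a ^ ('b \<times> 'c)"
    by (intro bounded_linear.tendsto[OF matrix_vector_mul_bounded_linear] x')

  have xs: "xs \<in> X"
    using closed_sequentially[OF X _ x'] step by (simp add: pdm_step_def)
  have ys: "ys \<in> dual_space I"
    using closed_sequentially[OF closed_subspace[OF subspace_dual_space] _ y']
      pdm_step_dual(2)[OF step] by blast

  have feas: "sub_mat A I *v xs = sub_vec b I"
  proof -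
    have bound: "norm (sub_mat A I *v x' j - sub_vec b I) \<le> norm (y' j - y j) / \<tau>" for j
    proof -
      let ?n = "norm (sub_mat A I *v x' j - sub_vec b I)"
      have "\<tau> * ?n \<le> t j * ?n" by (intro mult_right_mono \<tau>) simp
      also have "\<dots> = norm (t j *\<^sub>R sub_vec (A *v x' j - b) I)"
        using t[of j] by (simp add: sub_vec_residual)
      also have "\<dots> \<le> norm (y' j - y j)"
        using pdm_step_dual(1)[OF step, of j] norm_sub_vec_le[of "y' j - y j" I] by simp
      finally show ?thesis using \<tau>(1) by (simp add: field_simps)
    qed
    have "(\<lambda>j. norm (y' j - y j) / \<tau>) \<longlonglongrightarrow> 0" using tendsto_divide_zero[OF dy] .
    then have "(\<lambda>j. sub_mat A I *v x' j - sub_vec b I) \<longlonglongrightarrow> 0"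
      by (rule Lim_null_comparison[rotated]) (simp add: bound)
    moreover have "(\<lambda>j. sub_mat A I *v x' j - sub_vec b I) \<longlonglongrightarrow> sub_mat A I *v xs - sub_vec b I"
      by (intro tendsto_intros A_lim)
    ultimately show ?thesis using LIMSEQ_unique by fastforce
  qed

  define q where "q j = sub_vec (y j + t j *\<^sub>R (A *v x j - b)) I" for j
  have q: "q \<longlonglongrightarrow> ys"
  proof -
    have "(\<lambda>j. c * norm (x' j - x j)) \<longlonglongrightarrow> 0" using tendsto_mult_right_zero[OF dx] .
    then have "(\<lambda>j. q j - y' j) \<longlonglongrightarrow> 0"
      by (rule Lim_null_comparison[rotated])
        (simp add: q_def pdm_step_prediction_error[OF step c])
    from tendsto_add[OF this y'] show ?thesis by simp
  qed

  have "f xs \<le> f z + ys \<bullet> (A *v z - b)" if z: "z \<in> X" for z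
  proof -
    define e where "e j = (norm (z - x j))\<^sup>2 - (norm (z - x' j))\<^sup>2" for j
    have "(\<lambda>j. e j) \<longlonglongrightarrow> (norm (z - xs))\<^sup>2 - (norm (z - xs))\<^sup>2"
      unfolding e_def by (intro tendsto_intros x x')
    then have e: "(\<lambda>j. \<bar>e j\<bar> / (2 * \<tau>)) \<longlonglongrightarrow> 0"
      by (intro tendsto_divide_zero tendsto_rabs_zero) simp
    have "f (x' j) + q j \<bullet> (A *v x' j - b) \<le> f z + q j \<bullet> (A *v z - b) + \<bar>e j\<bar> / (2 * \<tau>)" for j
    proof -
      let ?d = "f (x' j) + q j \<bullet> (A *v x' j - b) - (f z + q j \<bullet> (A *v z - b))"
      have "2 * t j * (f (x' j) + q j \<bullet> (A *v x' j - b)) + (norm (x' j - x j))\<^sup>2 + (norm (z - x' j))\<^sup>2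
          \<le> 2 * t j * (f z + q j \<bullet> (A *v z - b)) + (norm (z - x j))\<^sup>2"
        using step[of j] z by (simp add: pdm_step_def q_def Let_def)
      then have "2 * t j * ?d \<le> e j - (norm (x' j - x j))\<^sup>2"
        unfolding e_def right_diff_distrib by linarith
      then have le: "2 * t j * ?d \<le> \<bar>e j\<bar>"
        using zero_le_power2[of "norm (x' j - x j)"] by linarith
      have "?d \<le> \<bar>e j\<bar> / (2 * \<tau>)"
      proof (cases "0 \<le> ?d")
        case True
        then have "2 * \<tau> * ?d \<le> 2 * t j * ?d" using \<tau>(2)[of j] by (intro mult_right_mono) auto
        with le have "2 * \<tau> * ?d \<le> \<bar>e j\<bar>" by linarith
        then show ?thesis using \<tau>(1) by (simp add: pos_le_divide_eq mult.commute)
      next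
        case False
        then show ?thesis using \<tau>(1) by (smt (verit) divide_nonneg_pos)
      qed
      then show ?thesis by simp
    qed
    moreover have "(\<lambda>j. f (x' j) + q j \<bullet> (A *v x' j - b)) \<longlonglongrightarrow> f xs + ys \<bullet> (A *v xs - b)"
      by (intro tendsto_intros q A_lim continuous_on_tendsto_compose[OF f x']) auto
    moreover have "(\<lambda>j. f z + q j \<bullet> (A *v z - b) + \<bar>e j\<bar> / (2 * \<tau>)) \<longlonglongrightarrow> f z + ys \<bullet> (A *v z - b) + 0"
      by (intro tendsto_add tendsto_inner tendsto_const q e)
    ultimately have "f xs + ys \<bullet> (A *v xs - b) \<le> f z + ys \<bullet> (A *v z - b)"
      using LIMSEQ_le by fastforce
    moreover have "ys \<bullet> (A *v xs - b) = 0"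
      using inner_dual_space[OF ys, of "A *v xs - b"] feas by (simp add: sub_vec_residual)
    ultimately show ?thesis by simp
  qed
  then show ?thesis using xs ys feas by (simp add: wseq saddle_points_iff)
qed

section \<open>Fejer monotone sequences\<close>

text \<open>
  The squared distances to \<open>z\<close> decrease to a limit, so their successive differences vanish, and
  these dominate the squared increments.
\<close>

lemma increments_tendsto_0:
  fixes w :: "nat \<Rightarrow> 'a::metric_space"
  assumes "0 < d"
    and fejer: "\<And>k. (dist (w (Suc k)) z)\<^sup>2 + d * (dist (w (Suc k)) (w k))\<^sup>2 \<le> (dist (w k) z)\<^sup>2"
  shows "(\<lambda>k. dist (w (Suc k)) (w k)) \<longlonglongrightarrow> 0"
proof -
  define a where "a k = (dist (w k) z)\<^sup>2" for k
  have le: "d * (dist (w (Suc k)) (w k))\<^sup>2 \<le> a k - a (Suc k)" for k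
    using fejer[of k] by (simp add: a_def)
  have "0 \<le> d * (dist (w (Suc k)) (w k))\<^sup>2" for k using \<open>0 < d\<close> by simp
  then have "a (Suc k) \<le> a k" for k using le[of k] by (smt (verit))
  then have "decseq a" by (rule decseq_SucI)
  then obtain l where l: "a \<longlonglongrightarrow> l" using decseq_convergent[of a 0] by (auto simp: a_def)
  have "(\<lambda>k. (a k - a (Suc k)) / d) \<longlonglongrightarrow> (l - l) / d"
    using \<open>0 < d\<close> by (intro tendsto_intros l LIMSEQ_Suc) simp
  then have lim: "(\<lambda>k. (a k - a (Suc k)) / d) \<longlonglongrightarrow> 0" by simp
  have "norm ((dist (w (Suc k)) (w k))\<^sup>2) \<le> (a k - a (Suc k)) / d" for k
    using le[of k] \<open>0 < d\<close> by (simp add: pos_le_divide_eq mult.commute)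
  then have "(\<lambda>k. (dist (w (Suc k)) (w k))\<^sup>2) \<longlonglongrightarrow> 0"
    by (intro Lim_null_comparison[OF _ lim]) simp
  from tendsto_real_sqrt[OF this] show ?thesis by simp
qed

lemma convergent_subseq_imp_tendsto:
  fixes w :: "nat \<Rightarrow> 'a::metric_space"
  assumes "\<And>k. dist (w (Suc k)) z \<le> dist (w k) z" and r: "strict_mono r" and "(w \<circ> r) \<longlonglongrightarrow> z"
  shows "w \<longlonglongrightarrow> z"
proof -
  define a where "a k = dist (w k) z" for k
  have "decseq a" using assms(1) by (simp add: a_def decseq_SucI)
  then obtain l where l: "a \<longlonglongrightarrow> l" using decseq_convergent[of a 0] by (auto simp: a_def)
  have "(a \<circ> r) \<longlonglongrightarrow> 0"
    using tendsto_dist_iff[of "w \<circ> r"] assms(3) by (simp add: a_def comp_def)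
  then have "a \<longlonglongrightarrow> 0" using LIMSEQ_unique LIMSEQ_subseq_LIMSEQ[OF l r] l by blast
  then show ?thesis unfolding a_def by (rule tendsto_dist_iff[THEN iffD2])
qed

lemma constant_subseq:
  fixes Is :: "nat \<Rightarrow> 'a::finite"
  shows "\<exists>(s :: nat \<Rightarrow> nat) I. strict_mono s \<and> (\<forall>j. Is (s j) = I)"
proof -
  obtain I where "infinite {k. Is k = I}"
    using pigeonhole_infinite[of "UNIV :: nat set" Is] by auto
  then show ?thesis
    using strict_mono_enumerate enumerate_in_set by blast
qed

section \<open>Convergence of the method\<close>

theorem theorem3:
  fixes X :: "(real ^ ('m::finite \<times> 'n::finite)) set"
    and f :: "real ^ ('m \<times> 'n) \<Rightarrow> real"
    and A :: "real ^ ('m \<times> 'n) ^ ('l::finite \<times> 'n)"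
    and b :: "real ^ ('l \<times> 'n)"
    and Is :: "nat \<Rightarrow> 'l set"
    and lam :: "nat \<Rightarrow> real"
    and p :: "nat \<Rightarrow> real ^ ('l \<times> 'n)"
    and w :: "nat \<Rightarrow> (real ^ ('m \<times> 'n)) \<times> (real ^ ('l \<times> 'n))"
    and \<tau> :: real
  assumes "convex X" and "closed X"
    and "solution_set f {x \<in> X. A *v x = b} \<noteq> {}"
    and "convex_on UNIV f"
    and "solution_set f X \<inter> feasible A b UNIV \<noteq> {}"
    and "PDM f X A b Is lam p w"
    and "0 < \<tau>" and "\<tau> < 1"
    and "\<And>k. k \<ge> 1 \<Longrightarrow> \<tau> \<le> lam k"
    and "\<And>k. k \<ge> 1 \<Longrightarrow> mat_norm (sub_mat A (Is k)) \<noteq> 0 \<Longrightarrow>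
           lam k \<le> sqrt (1 - \<tau>) / (sqrt 2 * mat_norm (sub_mat A (Is k)))"
  shows "limit_points w \<noteq> {} \<and>
    ((\<forall>k\<ge>1. basic_index_set A b (Is k)) \<longrightarrow> limit_points w \<subseteq> saddle_points f X A b UNIV) \<and>
    ((\<exists>I. I \<noteq> {} \<and> basic_index_set A b I \<and> (\<forall>k\<ge>1. I \<subseteq> Is k) \<and>
          (\<exists>s::nat \<Rightarrow> nat. strict_mono s \<and> (\<forall>j. Is (s j) = I))) \<longrightarrow>
       (\<exists>u\<in>saddle_points f X A b UNIV. w \<longlonglongrightarrow> u))"
proof -
  \<comment> \<open>The upper stepsize bound reads \<open>lam k * mat_norm (sub_mat A (Is k)) \<le> c\<close>.\<close>
  define c where "c = sqrt (1 - \<tau>) / sqrt 2"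
  have "1 - \<tau> < 2" using \<open>0 < \<tau>\<close> by simp
  then have c: "0 < c" "c < 1" using \<open>\<tau> < 1\<close> by (simp_all add: c_def)
  have cbound: "lam k * mat_norm (sub_mat A (Is k)) \<le> c" if "k \<ge> 1" for k
  proof (cases "mat_norm (sub_mat A (Is k)) = 0")
    case True
    then show ?thesis using c by simp
  next
    case False
    with mat_norm_nonneg have "0 < mat_norm (sub_mat A (Is k))" by (metis order_less_le)
    then show ?thesis
      using assms(10)[OF that False] by (simp add: c_def field_simps)
  qed
  note step = PDM_step[OF \<open>PDM f X A b Is lam p w\<close> \<open>convex_on UNIV f\<close> \<open>convex X\<close>]
  have f: "continuous_on UNIV f"
    using convex_on_continuous[OF open_UNIV] \<open>convex_on UNIV f\<close> by blast
  have fejer: "(dist (w (Suc k)) z)\<^sup>2 + (1 - c) * (dist (w (Suc k)) (w k))\<^sup>2 \<le> (dist (w k) z)\<^sup>2"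
    if "z \<in> saddle_points f X A b (Is (Suc k))" for k z
    using pdm_step_fejer[OF step[of "Suc k"] cbound that] by simp
  have closer: "dist (w (Suc k)) z \<le> dist (w k) z"
    if "z \<in> saddle_points f X A b (Is (Suc k))" for k z
  proof (rule power2_le_imp_le)
    have "0 \<le> (1 - c) * (dist (w (Suc k)) (w k))\<^sup>2" using c by simp
    then show "(dist (w (Suc k)) z)\<^sup>2 \<le> (dist (w k) z)\<^sup>2" using fejer[OF that] by linarith
  qed simp

  obtain xs where "xs \<in> solution_set f X" "xs \<in> feasible A b UNIV" using assms(5) by blast
  then have z0: "(xs, 0) \<in> saddle_points f X A b I" for I by (rule minimiser_saddle_point)
  have "dist (w k) (xs, 0) \<le> dist (w 0) (xs, 0)" for k
  proof (induction k)
    case (Suc k)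
    then show ?case using closer[OF z0, of k] by linarith
  qed simp
  then have "bounded (range w)"
    unfolding bounded_any_center[where a = "(xs, 0)"] by (auto simp: dist_commute)
  then have limit: "\<exists>z r. strict_mono r \<and> (w \<circ> s \<circ> r) \<longlonglongrightarrow> z" for s :: "nat \<Rightarrow> nat"
    by (rule bounded_imp_convergent_subsequence[OF bounded_subset]) auto
  have increments: "(\<lambda>k. dist (w (Suc k)) (w k)) \<longlonglongrightarrow> 0"
    using c fejer[OF z0] by (intro increments_tendsto_0[of "1 - c" w "(xs, 0)"]) auto

  have saddle_I: "z \<in> saddle_points f X A b I"
    if r: "strict_mono r" and rI: "\<And>j. Is (r j) = I" and lim: "(w \<circ> r) \<longlonglongrightarrow> z" for r z I
  proof (rule pdm_step_limit)
    \<comment> \<open>Dropping the first term makes every index positive, so that each has a predecessor.\<close>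
    define r' where "r' j = r (Suc j) - 1" for j
    have pos: "r (Suc j) \<ge> 1" for j using strict_monoD[OF r, of 0 "Suc j"] by simp
    have Suc_r': "Suc (r' j) = r (Suc j)" for j using pos[of j] by (simp add: r'_def)
    have r': "strict_mono r'"
      by (rule strict_monoI) (metis Suc_less_eq Suc_r' r strict_monoD)
    show "pdm_step f X A b I (lam (r (Suc j))) (w (r' j)) (w (r (Suc j)))" for j
      using step[OF pos, of j] by (simp add: rI r'_def)
    show lim': "(\<lambda>j. w (r (Suc j))) \<longlonglongrightarrow> z" using LIMSEQ_Suc[OF lim] by (simp add: comp_def)
    have "(\<lambda>j. norm (w (r' j) - w (r (Suc j)))) \<longlonglongrightarrow> 0"
      using LIMSEQ_subseq_LIMSEQ[OF increments r']
      by (simp add: comp_def Suc_r' dist_norm norm_minus_commute)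
    from Lim_transform[OF lim' tendsto_norm_zero_cancel[OF this]]
    show "(\<lambda>j. w (r' j)) \<longlonglongrightarrow> z" .
    show "0 < \<tau>" by fact
    show "\<tau> \<le> lam (r (Suc j))" for j using assms(9) pos by blast
    show "lam (r (Suc j)) * mat_norm (sub_mat A I) \<le> c" for j using cbound[OF pos, of j] by (simp add: rI)
  qed (fact f, fact \<open>closed X\<close>)

  show ?thesis
  proof (intro conjI impI)
    show "limit_points w \<noteq> {}" using limit[of id] by (auto simp: limit_points_def)
  next
    assume basic: "\<forall>k\<ge>1. basic_index_set A b (Is k)"
    show "limit_points w \<subseteq> saddle_points f X A b UNIV"
    proof
      fix z assume "z \<in> limit_points w"
      then obtain r where r: "strict_mono r" and lim: "(w \<circ> r) \<longlonglongrightarrow> z"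
        by (auto simp: limit_points_def)
      obtain I and s :: "nat \<Rightarrow> nat" where s: "strict_mono s" and I: "\<And>j. (Is \<circ> r) (s j) = I"
        using constant_subseq[of "Is \<circ> r"] by blast
      have rs: "strict_mono (r \<circ> s)" using r s by (rule strict_mono_o)
      have "(w \<circ> (r \<circ> s)) \<longlonglongrightarrow> z" using LIMSEQ_subseq_LIMSEQ[OF lim s] by (simp add: comp_assoc)
      then have zI: "z \<in> saddle_points f X A b I" using saddle_I[OF rs] I by simp
      have "(r \<circ> s) 1 \<ge> 1" by (rule seq_suble[OF rs])
      then have "basic_index_set A b I" using basic I[of 1] by fastforce
      then show "z \<in> saddle_points f X A b UNIV"
        using saddle_points_basic_mono zI by blast
    qed
  next
    assume "\<exists>I. I \<noteq> {} \<and> basic_index_set A b I \<and> (\<forall>k\<ge>1. I \<subseteq> Is k) \<and>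
      (\<exists>s::nat \<Rightarrow> nat. strict_mono s \<and> (\<forall>j. Is (s j) = I))"
    then obtain I and s :: "nat \<Rightarrow> nat" where basic: "basic_index_set A b I" and sub: "\<And>k. k \<ge> 1 \<Longrightarrow> I \<subseteq> Is k"
      and s: "strict_mono s" and I: "\<And>j. Is (s j) = I" by blast
    obtain z and r :: "nat \<Rightarrow> nat" where r: "strict_mono r" and lim: "(w \<circ> s \<circ> r) \<longlonglongrightarrow> z" using limit by blast
    have sr: "strict_mono (s \<circ> r)" using s r by (rule strict_mono_o)
    have lim: "(w \<circ> (s \<circ> r)) \<longlonglongrightarrow> z" using lim by (simp add: comp_assoc)
    have zI: "z \<in> saddle_points f X A b I" using saddle_I[OF sr _ lim] I by simp
    have "dist (w (Suc k)) z \<le> dist (w k) z" for k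
      using subsetD[OF saddle_points_basic_mono[OF basic sub[of "Suc k"]] zI] by (intro closer) simp
    then have "w \<longlonglongrightarrow> z" using sr lim by (rule convergent_subseq_imp_tendsto)
    then show "\<exists>u\<in>saddle_points f X A b UNIV. w \<longlonglongrightarrow> u"
      using zI saddle_points_basic_mono[OF basic subset_UNIV] by blast
  qed
qed

end
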